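(* Let $I=[a,b]\subset\mathbb{R}$ be a compact interval, let $f:I\to\mathbb{R}$, let $k\in\mathbb{N}$, and let $I_1,\dots,I_k$ be compact subintervals of $I$. If $f$ is Sequential Henstock integrable on $I$, then $f$ is Sequential Henstock integrable on $I_i$ for each $i=1,2,\dots,k$.
   Context: For a compact interval $J=[p,q]\subset\mathbb{R}$ with $p<q$: a tagged partition $P=\{([x_{i-1},x_i],t_i)\}_{i=1}^m$ of $J$ consists of points $p=x_0<x_1<\dots<x_m=q$ together with tags $t_i\in[x_{i-1},x_i]$. Its Riemann sum for $f$ is $S(f,P)=\sum_{i=1}^m f(t_i)(x_i-x_{i-1})$. A gauge on $J$ is a function $\delta:J\to\mathbb{R}$ with $\delta(x)>0$ for all $x\in J$. $P$ is $\delta(x)$-fine if $x_i-x_{i-1}<\delta(t_i)$ for every $i$. $f$ is Sequential Henstock integrable on $J$ with integral $A\in\mathbb{R}$ if there is a sequence of gauges $\{\delta_n\}_{n=1}^\infty$ on $J$ such that, whenever $P_n$ is a $\delta_n(x)$-fine tagged partition of $J$ for each $n$, one has $S(f,P_n)\to A$ as $n\to\infty$. *)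

theory Defs
  imports "HOL-Analysis.Analysis"
begin

text \<open>
  A triple \<open>(m, x, t)\<close> encodes the tagged partition with division points
  \<open>x 0 < x 1 < \<dots> < x m\<close> and tags \<open>t i \<in> {x (i - 1)..x i}\<close> for \<open>i = 1, \<dots>, m\<close>;
  other values of \<open>x\<close> and \<open>t\<close> are irrelevant. The library's tagged divisions are
  not used because they admit degenerate cells, and because gauges here are
  positive real functions rather than assignments of open neighbourhoods.
\<close>

type_synonym tagged_partition = "nat \<times> (nat \<Rightarrow> real) \<times> (nat \<Rightarrow> real)"

definition is_tagged_partition :: "real \<Rightarrow> real \<Rightarrow> tagged_partition \<Rightarrow> bool" where
  "is_tagged_partition p q P \<longleftrightarrow>
     (case P of (m, x, t) \<Rightarrow>
        x 0 = p \<and> x m = q \<and>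
        (\<forall>i\<in>{1..m}. x (i - 1) < x i \<and> t i \<in> {x (i - 1)..x i}))"

definition riemann_sum :: "(real \<Rightarrow> real) \<Rightarrow> tagged_partition \<Rightarrow> real" where
  "riemann_sum f P = (case P of (m, x, t) \<Rightarrow> \<Sum>i=1..m. f (t i) * (x i - x (i - 1)))"

definition is_gauge_on :: "real set \<Rightarrow> (real \<Rightarrow> real) \<Rightarrow> bool" where
  "is_gauge_on J \<delta> \<longleftrightarrow> (\<forall>x\<in>J. \<delta> x > 0)"

definition gauge_fine :: "(real \<Rightarrow> real) \<Rightarrow> tagged_partition \<Rightarrow> bool" where
  "gauge_fine \<delta> P \<longleftrightarrow> (case P of (m, x, t) \<Rightarrow> \<forall>i\<in>{1..m}. x i - x (i - 1) < \<delta> (t i))"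

text \<open>
  The following notions are intended for \<open>p < q\<close>. Functions on \<open>{p..q}\<close> are
  represented by total functions, whose values outside \<open>{p..q}\<close> are never used
  since all tags lie in \<open>{p..q}\<close>. Sequences are indexed from \<open>0\<close> instead of \<open>1\<close>.
\<close>

definition has_seq_henstock_integral ::
    "(real \<Rightarrow> real) \<Rightarrow> real \<Rightarrow> real \<Rightarrow> real \<Rightarrow> bool" where
  "has_seq_henstock_integral f A p q \<longleftrightarrow>
     (\<exists>\<delta> :: nat \<Rightarrow> real \<Rightarrow> real.
        (\<forall>n. is_gauge_on {p..q} (\<delta> n)) \<and>
        (\<forall>P :: nat \<Rightarrow> tagged_partition.
           (\<forall>n. is_tagged_partition p q (P n) \<and> gauge_fine (\<delta> n) (P n)) \<longrightarrow>
           (\<lambda>n. riemann_sum f (P n)) \<longlonglongrightarrow> A))"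

definition seq_henstock_integrable :: "(real \<Rightarrow> real) \<Rightarrow> real \<Rightarrow> real \<Rightarrow> bool" where
  "seq_henstock_integrable f p q \<longleftrightarrow> (\<exists>A. has_seq_henstock_integral f A p q)"

end

theory Submission
  imports Defs
begin

text \<open>
  Why a subinterval inherits integrability. Let the gauges \<open>\<delta> n\<close> witness integrability on
  \<open>{a..b}\<close>, and let \<open>{c..d}\<close> be a subinterval. If two \<open>\<delta> n\<close>-fine partitions of \<open>{c..d}\<close> are
  extended to \<open>{a..b}\<close> by the same \<open>\<delta> n\<close>-fine partitions of \<open>{a..c}\<close> and \<open>{d..b}\<close>, the
  contributions from outside \<open>{c..d}\<close> cancel in the difference of the two Riemann sums. Hence
  the Riemann sums over fine partitions of \<open>{c..d}\<close> satisfy a Cauchy condition, and completeness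
  of the reals supplies the integral over \<open>{c..d}\<close>.

  Three points need care. The definition speaks of sequences of partitions, so the Cauchy condition
  needs a bound that is uniform over all \<open>\<delta> n\<close>-fine partitions with \<open>n\<close> large
  (\<open>uniform_approximation\<close>). The extending partitions must exist, which is Cousin's lemma
  (\<open>fine_partition_exists\<close>). Finally, a partition that is fine for a late gauge need not be fine
  for an early one; replacing \<open>\<delta> n\<close> by the pointwise minimum of \<open>\<delta> 0, \<dots>, \<delta> n\<close> makes the
  gauges decrease (\<open>running_min_gauge\<close>), so that any two late partitions can be compared through
  a single gauge.
\<close>

text \<open>
  The case \<open>p = q\<close> is deliberately included: its only members have no cells, and
  they serve as the extension when the subinterval shares an end point with the whole interval.
\<close>

definition fine_partitions :: "(real \<Rightarrow> real) \<Rightarrow> real \<Rightarrow> real \<Rightarrow> tagged_partition set" where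
  "fine_partitions \<delta> p q = {P. is_tagged_partition p q P \<and> gauge_fine \<delta> P}"

fun append_partition :: "tagged_partition \<Rightarrow> tagged_partition \<Rightarrow> tagged_partition" where
  "append_partition (m, x, t) (n, y, s) =
     (m + n, \<lambda>i. if i \<le> m then x i else y (i - m), \<lambda>i. if i \<le> m then t i else s (i - m))"

lemma append_fine_partitions:
  assumes "P \<in> fine_partitions \<delta> p q" "Q \<in> fine_partitions \<delta> q r"
  shows "append_partition P Q \<in> fine_partitions \<delta> p r"
proof -
  obtain m x t where P: "P = (m, x, t)" by (cases P)
  obtain n y s where Q: "Q = (n, y, s)" by (cases Q)
  have ends: "x 0 = p" "x m = q" "y 0 = q" "y n = r"
    using assms by (auto simp: P Q fine_partitions_def is_tagged_partition_def)
  have cellP: "x (i - 1) < x i \<and> t i \<in> {x (i - 1)..x i} \<and> x i - x (i - 1) < \<delta> (t i)"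
    if "i \<in> {1..m}" for i
    using assms(1) that by (auto simp: P fine_partitions_def is_tagged_partition_def gauge_fine_def)
  have cellQ: "y (i - 1) < y i \<and> s i \<in> {y (i - 1)..y i} \<and> y i - y (i - 1) < \<delta> (s i)"
    if "i \<in> {1..n}" for i
    using assms(2) that by (auto simp: Q fine_partitions_def is_tagged_partition_def gauge_fine_def)
  define z where "z = (\<lambda>i. if i \<le> m then x i else y (i - m))"
  define u where "u = (\<lambda>i. if i \<le> m then t i else s (i - m))"
  have cell: "z (i - 1) < z i \<and> u i \<in> {z (i - 1)..z i} \<and> z i - z (i - 1) < \<delta> (u i)"
    if i: "i \<in> {1..m + n}" for i
  proof (cases "i \<le> m")
    case True
    then show ?thesis using cellP[of i] i by (auto simp: z_def u_def)
  next
    case False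
    \<comment> \<open>The first cell of \<open>Q\<close> starts at \<open>x m\<close> in the joint numbering, which equals \<open>y 0\<close>.\<close>
    have "z (i - 1) = y (i - m - 1)"
      using False ends by (cases "i = Suc m") (auto simp: z_def)
    moreover have "z i = y (i - m)" "u i = s (i - m)" "i - m \<in> {1..n}"
      using False i by (auto simp: z_def u_def)
    ultimately show ?thesis using cellQ by metis
  qed
  have "z 0 = p" "z (m + n) = r"
    using ends by (auto simp: z_def)
  then show ?thesis
    using cell
    by (auto simp: P Q fine_partitions_def is_tagged_partition_def gauge_fine_def
        simp flip: z_def u_def)
qed

lemma riemann_sum_append:
  assumes "P \<in> fine_partitions \<delta> p q" "Q \<in> fine_partitions \<delta> q r"
  shows "riemann_sum f (append_partition P Q) = riemann_sum f P + riemann_sum f Q"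
proof -
  obtain m x t where P: "P = (m, x, t)" by (cases P)
  obtain n y s where Q: "Q = (n, y, s)" by (cases Q)
  have join: "x m = y 0"
    using assms by (auto simp: P Q fine_partitions_def is_tagged_partition_def)
  define z where "z = (\<lambda>i. if i \<le> m then x i else y (i - m))"
  define u where "u = (\<lambda>i. if i \<le> m then t i else s (i - m))"
  have "(\<Sum>i=1..m + n. f (u i) * (z i - z (i - 1))) =
        (\<Sum>i=1..m. f (u i) * (z i - z (i - 1))) + (\<Sum>i=m + 1..m + n. f (u i) * (z i - z (i - 1)))"
    by (rule sum.ub_add_nat) simp
  also have "(\<Sum>i=1..m. f (u i) * (z i - z (i - 1))) = (\<Sum>i=1..m. f (t i) * (x i - x (i - 1)))"
    by (rule sum.cong) (auto simp: z_def u_def)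
  also have "(\<Sum>i=m + 1..m + n. f (u i) * (z i - z (i - 1))) =
             (\<Sum>i=1..n. f (u (i + m)) * (z (i + m) - z (i + m - 1)))"
    using sum.shift_bounds_cl_nat_ivl[of "\<lambda>i. f (u i) * (z i - z (i - 1))" 1 m n]
    by (simp add: add.commute)
  also have "\<dots> = (\<Sum>i=1..n. f (s i) * (y i - y (i - 1)))"
  proof (rule sum.cong)
    fix i assume "i \<in> {1..n}"
    then have "z (i + m - 1) = y (i - 1)"
      using join by (cases "i = 1") (auto simp: z_def)
    with \<open>i \<in> {1..n}\<close> show "f (u (i + m)) * (z (i + m) - z (i + m - 1)) = f (s i) * (y i - y (i - 1))"
      by (auto simp: z_def u_def)
  qed simp
  finally show ?thesis
    by (simp add: P Q riemann_sum_def flip: z_def u_def)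
qed

text \<open>
  Cousin's lemma, by the compactness principle \<open>Bolzano\<close>: fine partitions of adjacent intervals can
  be joined, and around each point \<open>x\<close> every interval shorter than \<open>\<delta> x\<close> is a single fine cell
  tagged at \<open>x\<close>.
\<close>

lemma fine_partition_exists:
  assumes "p \<le> q" "is_gauge_on {p..q} \<delta>"
  shows "fine_partitions \<delta> p q \<noteq> {}"
  using \<open>p \<le> q\<close>
proof (induction rule: Bolzano)
  case (trans u v w)
  then show ?case using append_fine_partitions by fast
next
  case (local x)
  have "fine_partitions \<delta> u v \<noteq> {}" if "u \<le> x" "x \<le> v" "v - u < \<delta> x" for u v
  proof (cases "u = v")
    case True
    then have "(0, \<lambda>_. u, \<lambda>_. u) \<in> fine_partitions \<delta> u v"
      by (simp add: fine_partitions_def is_tagged_partition_def gauge_fine_def)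
    then show ?thesis by blast
  next
    case False
    with that have "(1, \<lambda>i. if i = 0 then u else v, \<lambda>_. x) \<in> fine_partitions \<delta> u v"
      by (simp add: fine_partitions_def is_tagged_partition_def gauge_fine_def)
    then show ?thesis by blast
  qed
  moreover have "\<delta> x > 0"
    using local assms(2) by (simp add: is_gauge_on_def)
  ultimately show ?case by blast
qed

lemma is_gauge_on_subset: "is_gauge_on K \<delta> \<Longrightarrow> J \<subseteq> K \<Longrightarrow> is_gauge_on J \<delta>"
  by (auto simp: is_gauge_on_def)

lemma fine_partitions_mono:
  assumes "\<And>x. \<delta> x \<le> \<eta> x"
  shows "fine_partitions \<delta> p q \<subseteq> fine_partitions \<eta> p q"
  using assms unfolding fine_partitions_def gauge_fine_def
  by (auto split: prod.splits) (meson order_less_le_trans atLeastAtMost_iff)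

definition running_min_gauge :: "(nat \<Rightarrow> real \<Rightarrow> real) \<Rightarrow> nat \<Rightarrow> real \<Rightarrow> real" where
  "running_min_gauge \<delta> n x = Min ((\<lambda>j. \<delta> j x) ` {..n})"

lemma is_gauge_on_running_min:
  "(\<And>n. is_gauge_on J (\<delta> n)) \<Longrightarrow> is_gauge_on J (running_min_gauge \<delta> n)"
  by (auto simp: is_gauge_on_def running_min_gauge_def)

lemma fine_partitions_running_min:
  assumes "j \<le> n"
  shows "fine_partitions (running_min_gauge \<delta> n) p q \<subseteq> fine_partitions (\<delta> j) p q"
  using assms by (intro fine_partitions_mono) (auto simp: running_min_gauge_def intro!: Min_le)

text \<open>
  Otherwise a sequence that takes, at each stage where there is one, a fine partition whose sum
  misses \<open>A\<close> by at least \<open>\<epsilon>\<close> would not converge to \<open>A\<close>; Cousin's lemma fills the remaining stages.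
\<close>

lemma uniform_approximation:
  assumes "p \<le> q" and gauge: "\<And>n. is_gauge_on {p..q} (\<delta> n)"
    and conv: "\<And>P. (\<And>n. P n \<in> fine_partitions (\<delta> n) p q) \<Longrightarrow> (\<lambda>n. riemann_sum f (P n)) \<longlonglongrightarrow> A"
    and "\<epsilon> > 0"
  obtains N where "\<And>n P. n \<ge> N \<Longrightarrow> P \<in> fine_partitions (\<delta> n) p q \<Longrightarrow> \<bar>riemann_sum f P - A\<bar> < \<epsilon>"
proof -
  have "\<exists>P \<in> fine_partitions (\<delta> n) p q.
          \<forall>Q \<in> fine_partitions (\<delta> n) p q. \<bar>riemann_sum f P - A\<bar> < \<epsilon> \<longrightarrow> \<bar>riemann_sum f Q - A\<bar> < \<epsilon>" for n
    using fine_partition_exists[OF \<open>p \<le> q\<close> gauge] by blast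
  then obtain P where P: "\<And>n. P n \<in> fine_partitions (\<delta> n) p q"
    and worst: "\<And>n Q. Q \<in> fine_partitions (\<delta> n) p q \<Longrightarrow> \<bar>riemann_sum f (P n) - A\<bar> < \<epsilon> \<Longrightarrow>
                  \<bar>riemann_sum f Q - A\<bar> < \<epsilon>"
    by metis
  obtain N where "\<And>n. n \<ge> N \<Longrightarrow> \<bar>riemann_sum f (P n) - A\<bar> < \<epsilon>"
    using LIMSEQ_D[OF conv[OF P] \<open>\<epsilon> > 0\<close>] by auto
  then show ?thesis using worst that by blast
qed

lemma riemann_sum_diff_on_subinterval:
  assumes "a \<le> c" "d \<le> b" and gauge: "is_gauge_on {a..b} \<delta>" and "c \<le> d"
    and close: "\<And>P. P \<in> fine_partitions \<delta> a b \<Longrightarrow> \<bar>riemann_sum f P - A\<bar> < \<epsilon>"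
    and Q: "Q \<in> fine_partitions \<delta> c d" and R: "R \<in> fine_partitions \<delta> c d"
  shows "\<bar>riemann_sum f Q - riemann_sum f R\<bar> < 2 * \<epsilon>"
proof -
  obtain L where L: "L \<in> fine_partitions \<delta> a c"
    using fine_partition_exists[of a c \<delta>] is_gauge_on_subset[OF gauge, of "{a..c}"] assms by auto
  obtain U where U: "U \<in> fine_partitions \<delta> d b"
    using fine_partition_exists[of d b \<delta>] is_gauge_on_subset[OF gauge, of "{d..b}"] assms by auto
  have extend: "\<bar>riemann_sum f L + riemann_sum f X + riemann_sum f U - A\<bar> < \<epsilon>"
    if X: "X \<in> fine_partitions \<delta> c d" for X
  proof -
    have LX: "append_partition L X \<in> fine_partitions \<delta> a d"
      using append_fine_partitions[OF L X] .
    show ?thesis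
      using close[OF append_fine_partitions[OF LX U]]
      by (simp add: riemann_sum_append[OF LX U] riemann_sum_append[OF L X])
  qed
  show ?thesis
    using extend[OF Q] extend[OF R] by linarith
qed

lemma seq_henstock_integrable_subinterval:
  assumes "c \<le> d" "{c..d} \<subseteq> {a..b}" "seq_henstock_integrable f a b"
  shows "seq_henstock_integrable f c d"
proof -
  have bounds: "a \<le> c" "d \<le> b" "a \<le> b"
    using assms(1,2) by auto
  obtain A \<delta> where gauge: "\<And>n. is_gauge_on {a..b} (\<delta> n)"
    and conv: "\<And>P. (\<And>n. P n \<in> fine_partitions (\<delta> n) a b) \<Longrightarrow> (\<lambda>n. riemann_sum f (P n)) \<longlonglongrightarrow> A"
    using assms(3)
    by (auto simp: seq_henstock_integrable_def has_seq_henstock_integral_def fine_partitions_def)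
  define \<eta> where "\<eta> = running_min_gauge \<delta>"
  have gauge_\<eta>: "is_gauge_on {c..d} (\<eta> n)" for n
    unfolding \<eta>_def using gauge is_gauge_on_subset assms(2) by (blast intro: is_gauge_on_running_min)
  have cauchy: "\<exists>N. \<forall>m\<ge>N. \<forall>n\<ge>N. \<forall>Q\<in>fine_partitions (\<eta> m) c d. \<forall>R\<in>fine_partitions (\<eta> n) c d.
                  \<bar>riemann_sum f Q - riemann_sum f R\<bar> < \<epsilon>" if "\<epsilon> > 0" for \<epsilon>
  proof -
    from \<open>\<epsilon> > 0\<close> have "\<epsilon> / 2 > 0" by simp
    then obtain N where N: "\<And>n P. n \<ge> N \<Longrightarrow> P \<in> fine_partitions (\<delta> n) a b \<Longrightarrow>
                              \<bar>riemann_sum f P - A\<bar> < \<epsilon> / 2"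
      using uniform_approximation[of a b \<delta> f A "\<epsilon> / 2"] bounds(3) gauge conv by blast
    have "\<bar>riemann_sum f Q - riemann_sum f R\<bar> < \<epsilon>"
      if "m \<ge> N" "n \<ge> N" "Q \<in> fine_partitions (\<eta> m) c d" "R \<in> fine_partitions (\<eta> n) c d" for m n Q R
    proof -
      have "Q \<in> fine_partitions (\<delta> N) c d" "R \<in> fine_partitions (\<delta> N) c d"
        using that fine_partitions_running_min unfolding \<eta>_def by blast+
      then show ?thesis
        using riemann_sum_diff_on_subinterval[OF bounds(1,2) gauge assms(1) N[OF order_refl]] by simp
    qed
    then show ?thesis by blast
  qed
  have "\<forall>n. \<exists>P. P \<in> fine_partitions (\<eta> n) c d"
    using fine_partition_exists[OF assms(1) gauge_\<eta>] by blast
  then obtain Q where Q: "\<And>n. Q n \<in> fine_partitions (\<eta> n) c d"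
    by metis
  have "Cauchy (\<lambda>n. riemann_sum f (Q n))"
    unfolding Cauchy_def dist_real_def using cauchy Q by meson
  then obtain B where B: "(\<lambda>n. riemann_sum f (Q n)) \<longlonglongrightarrow> B"
    using Cauchy_convergent convergent_def by blast
  have "(\<lambda>n. riemann_sum f (P n)) \<longlonglongrightarrow> B" if P: "\<And>n. P n \<in> fine_partitions (\<eta> n) c d" for P
  proof -
    have "(\<lambda>n. riemann_sum f (P n) - riemann_sum f (Q n)) \<longlonglongrightarrow> 0"
      unfolding LIMSEQ_iff real_norm_def diff_0_right using cauchy P Q by meson
    from tendsto_add[OF this B] show ?thesis by simp
  qed
  then have "has_seq_henstock_integral f B c d"
    unfolding has_seq_henstock_integral_def using gauge_\<eta>
    by (intro exI[of _ \<eta>]) (auto simp: fine_partitions_def)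
  then show ?thesis
    by (auto simp: seq_henstock_integrable_def)
qed

theorem theorem8:
  fixes a b :: real and f :: "real \<Rightarrow> real" and k :: nat and p q :: "nat \<Rightarrow> real"
  assumes "a < b"
    and "\<And>i. i \<in> {1..k} \<Longrightarrow> p i < q i"
    and "\<And>i. i \<in> {1..k} \<Longrightarrow> {p i..q i} \<subseteq> {a..b}"
    and "seq_henstock_integrable f a b"
  shows "\<forall>i\<in>{1..k}. seq_henstock_integrable f (p i) (q i)"
  using assms(2-4) by (blast intro: seq_henstock_integrable_subinterval less_imp_le)

end
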